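(* Let $k$ be a field of characteristic two, and let $f\in k[X]$ be a monic polynomial of degree $n\geq 1$. Then $f$ is the minimal polynomial of a symmetric matrix with entries in $k$ (of some size) if and only if $f$ is not the product of pairwise distinct monic irreducible inseparable polynomials of $k[X]$. In this case, $f$ is the minimal polynomial of a symmetric matrix of $\mathrm{M}_n(k)$. In particular, if $k$ is perfect, any monic polynomial $f\in k[X]$ of degree $n\geq 1$ is the minimal polynomial of a symmetric matrix of $\mathrm{M}_n(k)$.
   Context: $\mathrm{M}_n(k)$ denotes the ring of $n\times n$ matrices with entries in $k$. An irreducible polynomial of $k[X]$ is separable if it has no multiple root in an algebraic closure of $k$, and inseparable otherwise. A product of pairwise distinct polynomials may consist of a single factor. *)

theory Defs
  imports
    "Jordan_Normal_Form.Matrix"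
    "HOL-Algebra.Algebraic_Closure_Type"
begin

text \<open>Matrices of type \<^typ>\<open>'a mat\<close> carry their dimensions as data and do not form an additive
  monoid, so the value of a polynomial at a square matrix is given entry by entry.\<close>

definition poly_mat :: "'a::comm_ring_1 poly \<Rightarrow> 'a mat \<Rightarrow> 'a mat" where
  "poly_mat p A = mat (dim_row A) (dim_row A)
     (\<lambda>(i, j). \<Sum>k\<le>Polynomial.degree p. Polynomial.coeff p k * (A ^\<^sub>m k) $$ (i, j))"

definition is_minimal_polynomial :: "'a::field mat \<Rightarrow> 'a poly \<Rightarrow> bool" where
  "is_minimal_polynomial A f \<longleftrightarrow>
     Polynomial.lead_coeff f = 1 \<and>
     (\<forall>p. poly_mat p A = 0\<^sub>m (dim_row A) (dim_row A) \<longleftrightarrow> f dvd p)"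

text \<open>Only meaningful for nonzero polynomials; it is applied to irreducible ones.\<close>

definition separable_poly :: "'a::field poly \<Rightarrow> bool" where
  "separable_poly p \<longleftrightarrow>
     (\<forall>x :: 'a alg_closure. Polynomial.order x (map_poly to_ac p) \<le> 1)"

definition perfect_field :: "'a::field itself \<Rightarrow> bool" where
  "perfect_field _ \<longleftrightarrow>
     (\<forall>p :: 'a poly. Factorial_Ring.irreducible p \<longrightarrow> separable_poly p)"

text \<open>The empty product is allowed here; it is \<open>1\<close>, hence never of positive degree.\<close>

definition distinct_inseparable_product :: "'a::field poly \<Rightarrow> bool" where
  "distinct_inseparable_product f \<longleftrightarrow>
     (\<exists>S. finite S \<and>
          (\<forall>p\<in>S. Polynomial.lead_coeff p = 1 \<and> Factorial_Ring.irreducible p \<and>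
                 \<not> separable_poly p) \<and>
          f = \<Prod>S)"

end

theory Submission
  imports Defs
begin

text \<open>Multiplication by \<open>X\<close> on \<open>k[X]/(f)\<close> has minimal polynomial \<open>f\<close>, and its matrix is symmetric in any
  orthonormal basis for a form \<open>(x, y) \<mapsto> \<phi>(xy)\<close> with \<open>\<phi>\<close> linear.
  In characteristic two a nondegenerate form has an orthonormal basis as soon as it is not alternating
  and all values \<open>\<phi>(x\<^sup>2)\<close> are squares. Take \<open>\<phi>(x)\<close> to be the coefficient of \<open>X\<^bsup>n-1\<^esup>\<close> in \<open>u x mod f\<close>: the
  form is nondegenerate if \<open>u\<close> is prime to \<open>f\<close>, and if \<open>(u f)' = b\<^sup>2\<close> then \<open>\<phi>(x\<^sup>2)\<close> is the square of the
  coefficient of \<open>X\<^bsup>n-1\<^esup>\<close> in \<open>b x mod f\<close>, so the form is not alternating if \<open>f\<close> does not divide \<open>b\<close>.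
  Such a pair \<open>(u, b)\<close> with \<open>f\<close> not dividing \<open>b\<close> exists for every power of an irreducible polynomial except an inseparable irreducible
  polynomial itself, where \<open>u = 1\<close>, \<open>b = 0\<close> still gives an alternating form; pairs for coprime factors are
  combined by adding the fractions \<open>u / f\<close>.

  Conversely, a symmetric matrix \<open>A\<close> with \<open>f(A) = 0\<close> and \<open>f' = 0\<close> forces \<open>f\<close> to have a square factor, namely
  the square of the minimal polynomial of the all-ones vector.\<close>

hide_const (open) Polynomials.degree Polynomials.lead_coeff Divisibility.irreducible Coset.order

section \<open>Irreducible polynomials and comaximality\<close>

definition comaximal :: "'a::comm_ring_1 \<Rightarrow> 'a \<Rightarrow> bool" where
  "comaximal a b \<longleftrightarrow> (\<exists>s t. s * a + t * b = 1)"

lemma comaximal_commute: "comaximal a b \<longleftrightarrow> comaximal b a"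
  unfolding comaximal_def by (metis add.commute)

lemma comaximal_1_left [simp]: "comaximal 1 b"
  unfolding comaximal_def by (rule exI[of _ 1], rule exI[of _ 0]) simp

lemma comaximal_add_mult: "comaximal (a + c * b) b \<longleftrightarrow> comaximal a b"
proof -
  have *: "comaximal (a + c * b) b" if "comaximal a b" for a b c :: 'a
  proof -
    from that obtain s t where "s * a + t * b = 1" unfolding comaximal_def by blast
    then have "s * (a + c * b) + (t - s * c) * b = 1" by (simp add: algebra_simps)
    then show ?thesis unfolding comaximal_def by blast
  qed
  from *[of a b c] *[of "a + c * b" b "- c"] show ?thesis by auto
qed

lemma comaximal_mult_right:
  assumes "comaximal a b" "comaximal a c"
  shows "comaximal a (b * c)"
proof -
  from assms obtain s t s' t' where *: "s * a + t * b = 1" "s' * a + t' * c = 1"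
    unfolding comaximal_def by blast
  have "(s * a + t * b) * (s' * a + t' * c) = 1" using * by simp
  then have "(s * s' * a + s * t' * c + t * b * s') * a + (t * t') * (b * c) = 1"
    by (simp add: algebra_simps)
  then show ?thesis unfolding comaximal_def by blast
qed

lemma comaximal_mult_left:
  "comaximal a c \<Longrightarrow> comaximal b c \<Longrightarrow> comaximal (a * b) c"
  using comaximal_mult_right comaximal_commute by metis

lemma comaximal_power_right: "comaximal a b \<Longrightarrow> comaximal a (b ^ n)"
  by (induction n) (auto intro: comaximal_mult_right simp: comaximal_commute[of a 1])

lemma comaximal_dvd_mult_cancel:
  assumes "comaximal a b" "a dvd b * c"
  shows "a dvd c"
proof -
  from assms obtain s t where st: "s * a + t * b = 1" unfolding comaximal_def by blast
  have "c = (s * a + t * b) * c" by (simp add: st)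
  also have "\<dots> = a * (s * c) + t * (b * c)" by (simp add: algebra_simps)
  finally show ?thesis using assms(2) by (metis dvd_add dvd_mult dvd_triv_left)
qed

text \<open>The ideal \<open>I\<close> is generated by a nonzero member \<open>d\<close> of least
  degree. As \<open>d\<close> divides \<open>p\<close>, it is a unit or associated to
  \<open>p\<close>, and the latter would give \<open>p dvd g\<close>.\<close>

lemma irreducible_imp_comaximal:
  fixes p g :: "'a::field poly"
  assumes p: "irreducible p" and g: "\<not> p dvd g"
  shows "comaximal p g"
proof -
  define I where "I = {s * p + t * g | s t. True}"
  have I_diff: "x - q * y \<in> I" if xy: "x \<in> I" "y \<in> I" for x y q
  proof -
    from xy obtain s t s' t' where "x = s * p + t * g" "y = s' * p + t' * g"
      unfolding I_def by blast
    then have "x - q * y = (s - q * s') * p + (t - q * t') * g" by (simp add: algebra_simps)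
    then show ?thesis unfolding I_def by blast
  qed
  have pI: "p \<in> I" unfolding I_def by (rule CollectI, rule exI[of _ 1], rule exI[of _ 0]) simp
  have gI: "g \<in> I" unfolding I_def by (rule CollectI, rule exI[of _ 0], rule exI[of _ 1]) simp
  have "\<exists>d. (d \<in> I \<and> d \<noteq> 0) \<and> (\<forall>y. y \<in> I \<and> y \<noteq> 0 \<longrightarrow> degree d \<le> degree y)"
    by (rule ex_has_least_nat[of _ p]) (use pI p in \<open>auto simp: Factorial_Ring.irreducible_def\<close>)
  then obtain d where d: "d \<in> I" "d \<noteq> 0" and least: "\<And>y. y \<in> I \<Longrightarrow> y \<noteq> 0 \<Longrightarrow> degree d \<le> degree y"
    by blast
  have dvd: "d dvd x" if "x \<in> I" for x
  proof -
    have "x mod d \<in> I" using I_diff[OF that d(1), of "x div d"] by (simp add: minus_div_mult_eq_mod)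
    then show ?thesis using least[of "x mod d"] degree_mod_less[OF d(2), of x]
      by (metis dvd_eq_mod_eq_0 leD)
  qed
  from dvd[OF pI] obtain q where q: "p = d * q" by blast
  with p have "d dvd 1 \<or> q dvd 1" unfolding Factorial_Ring.irreducible_def by blast
  moreover have "\<not> q dvd 1"
  proof
    assume "q dvd 1"
    then have "p dvd d" by (simp add: q mult_unit_dvd_iff)
    with g dvd[OF gI] show False using dvd_trans by blast
  qed
  ultimately obtain e where e: "1 = d * e" by (auto elim: dvdE)
  from d(1) obtain s t where "d = s * p + t * g" unfolding I_def by blast
  with e have "(e * s) * p + (e * t) * g = 1" by (simp add: algebra_simps)
  then show ?thesis unfolding comaximal_def by blast
qed

text \<open>A divisor of least positive degree has no proper factorisation.\<close>

lemma exists_monic_irreducible_factor: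
  fixes f :: "'a::field poly"
  assumes "degree f > 0"
  shows "\<exists>p. irreducible p \<and> lead_coeff p = 1 \<and> p dvd f"
proof -
  have "\<exists>d. (d dvd f \<and> degree d > 0) \<and> (\<forall>y. y dvd f \<and> degree y > 0 \<longrightarrow> degree d \<le> degree y)"
    by (rule ex_has_least_nat[of _ f]) (use assms in auto)
  then obtain d where d: "d dvd f" "degree d > 0"
    and least: "\<And>y. y dvd f \<Longrightarrow> degree y > 0 \<Longrightarrow> degree d \<le> degree y" by blast
  from d have d0: "d \<noteq> 0" by auto
  define p where "p = smult (inverse (lead_coeff d)) d"
  have pd: "p dvd d" "d dvd p" using d0 by (simp_all add: p_def smult_dvd_iff dvd_smult_iff)
  have dp: "degree p = degree d" using d0 by (simp add: p_def)
  have "irreducible p"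
  proof (rule Factorial_Ring.irreducibleI)
    show p0: "p \<noteq> 0" using d0 by (simp add: p_def)
    show "\<not> p dvd 1" using dp d(2) by (auto dest: divides_degree)
    fix a b assume ab: "p = a * b"
    with p0 have "a \<noteq> 0" "b \<noteq> 0" by auto
    then have deg: "degree p = degree a + degree b" using ab by (simp add: degree_mult_eq)
    have "a dvd f" using ab pd d by (meson dvd_trans dvd_triv_left)
    then have "degree a = 0 \<or> degree b = 0" using least[of a] deg dp by (cases "degree a = 0") simp_all
    with \<open>a \<noteq> 0\<close> \<open>b \<noteq> 0\<close> show "a dvd 1 \<or> b dvd 1" by (auto simp: is_unit_iff_degree)
  qed
  moreover have "lead_coeff p = 1" using d0 by (simp add: p_def)
  ultimately show ?thesis using pd d by (meson dvd_trans)
qed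

lemma degree_pos_if_irreducible:
  fixes p :: "'a::field poly"
  assumes "irreducible p" shows "degree p > 0"
  using assms by (auto simp: Factorial_Ring.irreducible_def is_unit_iff_degree)

lemma irreducible_comaximal_pderiv:
  fixes p :: "'a::field poly"
  assumes "irreducible p" "pderiv p \<noteq> 0"
  shows "comaximal p (pderiv p)"
proof (rule irreducible_imp_comaximal[OF assms(1)])
  have "degree (pderiv p) < degree p"
    using degree_pos_if_irreducible[OF assms(1)]
    by (intro le_less_trans[OF degree_le[of "degree p - 1"]])
       (auto simp: coeff_pderiv coeff_eq_0)
  then show "\<not> p dvd pderiv p" using assms(2) by (metis dvd_imp_degree_le leD)
qed

section \<open>Separability of irreducible polynomials and the derivative\<close>

lemma map_poly_to_ac_mult:
  "map_poly to_ac (p * q) = map_poly to_ac p * map_poly to_ac q"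
  by (rule poly_eqI) (simp add: coeff_map_poly coeff_mult to_ac_sum)

lemma map_poly_to_ac_pderiv:
  "map_poly to_ac (pderiv p) = pderiv (map_poly to_ac p)"
  by (rule poly_eqI) (simp add: coeff_map_poly coeff_pderiv)

lemma square_dvd_iff_root_pderiv:
  fixes p :: "'a::field poly"
  shows "[:- x, 1:]\<^sup>2 dvd p \<longleftrightarrow> poly p x = 0 \<and> poly (pderiv p) x = 0"
proof
  assume "[:- x, 1:]\<^sup>2 dvd p"
  then obtain q where "p = [:- x, 1:]\<^sup>2 * q" by blast
  then show "poly p x = 0 \<and> poly (pderiv p) x = 0"
    by (simp add: pderiv_mult power2_eq_square del: mult_pCons_left mult_pCons_right)
next
  assume *: "poly p x = 0 \<and> poly (pderiv p) x = 0"
  then obtain q where q: "p = [:- x, 1:] * q" by (auto simp: poly_eq_0_iff_dvd)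
  have "pderiv [:- x, 1:] = 1" by (simp add: pderiv_pCons)
  with * q have "poly q x = 0" by (simp add: pderiv_mult del: mult_pCons_left mult_pCons_right)
  then show "[:- x, 1:]\<^sup>2 dvd p"
    by (simp add: q power2_eq_square poly_eq_0_iff_dvd mult_dvd_mono del: mult_pCons_left mult_pCons_right)
qed

text \<open>If the derivative is zero, every root in the closure is multiple; otherwise a Bezout
  identity between \<open>p\<close> and its derivative carries over to the closure and excludes a
  common root.\<close>

lemma irreducible_separable_iff_pderiv:
  fixes p :: "'a::field poly"
  assumes p: "irreducible p"
  shows "separable_poly p \<longleftrightarrow> pderiv p \<noteq> 0"
proof -
  let ?P = "map_poly to_ac p"
  have P0: "?P \<noteq> 0" using p by (auto simp: Factorial_Ring.irreducible_def map_poly_eq_0_iff)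
  have "separable_poly p \<longleftrightarrow> \<not> (\<exists>x. [:- x, 1:]\<^sup>2 dvd ?P)"
    unfolding separable_poly_def order_divides using P0
    by (simp only: simp_thms not_ex) (simp add: not_le numeral_2_eq_2 less_Suc_eq_le)
  also have "\<dots> \<longleftrightarrow> \<not> (\<exists>x. poly ?P x = 0 \<and> poly (map_poly to_ac (pderiv p)) x = 0)"
    by (simp add: square_dvd_iff_root_pderiv map_poly_to_ac_pderiv)
  also have "\<dots> \<longleftrightarrow> pderiv p \<noteq> 0"
  proof (cases "pderiv p = 0")
    case True
    have "degree ?P > 0" using degree_pos_if_irreducible[OF p] by (simp add: degree_map_poly)
    then obtain x where "poly ?P x = 0" using alg_closed_imp_poly_has_root by blast
    with True show ?thesis by auto
  next
    case False
    from irreducible_comaximal_pderiv[OF p False] obtain s t where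
      "s * p + t * pderiv p = 1" unfolding comaximal_def by blast
    then have "map_poly to_ac (s * p + t * pderiv p) = 1" by simp
    moreover have "map_poly to_ac (a + b) = map_poly to_ac a + map_poly to_ac b" for a b :: "'a poly"
      by (rule poly_eqI) (simp add: coeff_map_poly)
    ultimately have "map_poly to_ac s * ?P + map_poly to_ac t * map_poly to_ac (pderiv p) = 1"
      by (simp add: map_poly_to_ac_mult)
    then have "poly (map_poly to_ac s * ?P + map_poly to_ac t * map_poly to_ac (pderiv p)) x = 1" for x
      by simp
    then show ?thesis using False by auto (metis add.left_neutral mult_zero_right zero_neq_one)
  qed
  finally show ?thesis .
qed

section \<open>Making the derivative of a multiple a square\<close>

lemma char_two_add_self:
  fixes x :: "'a::comm_ring_1"
  assumes "CHAR('a) = 2" shows "x + x = 0"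
proof -
  have "x + x = of_nat CHAR('a) * x" unfolding assms by simp
  then show ?thesis by (simp only: of_nat_CHAR mult_zero_left)
qed

lemma char_two_power2_add:
  fixes x y :: "'a::comm_ring_1"
  assumes "CHAR('a) = 2" shows "(x + y)\<^sup>2 = x\<^sup>2 + y\<^sup>2"
  using char_two_add_self[OF assms, of "x * y"]
  by (simp add: power2_eq_square algebra_simps)

lemma char_two_power2_sum:
  fixes g :: "'b \<Rightarrow> 'a::comm_ring_1"
  assumes "CHAR('a) = 2" shows "(\<Sum>i\<in>I. g i)\<^sup>2 = (\<Sum>i\<in>I. (g i)\<^sup>2)"
  by (induction I rule: infinite_finite_induct) (simp_all add: char_two_power2_add[OF assms])

lemma char_two_pderiv_square_mult:
  fixes s h :: "'a::field poly"
  assumes "CHAR('a) = 2" shows "pderiv (s\<^sup>2 * h) = s\<^sup>2 * pderiv h"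
proof -
  have "pderiv (s\<^sup>2) = s * pderiv s + s * pderiv s"
    by (simp add: power2_eq_square pderiv_mult mult.commute)
  also have "\<dots> = 0" using assms by (intro char_two_add_self) simp
  finally show ?thesis by (simp add: pderiv_mult)
qed

text \<open>Each coefficient gets multiplied by two consecutive integers, one of them even.\<close>

lemma char_two_pderiv_pderiv:
  fixes p :: "'a::field poly"
  assumes "CHAR('a) = 2" shows "pderiv (pderiv p) = 0"
proof (rule poly_eqI)
  fix i
  have "of_nat (Suc i * Suc (Suc i)) = (0::'a)"
    unfolding of_nat_eq_0_iff_char_dvd assms by simp
  then have "of_nat (Suc i) * (of_nat (Suc (Suc i)) * c) = 0" for c :: 'a
    unfolding of_nat_mult mult.assoc[symmetric] by simp
  then show "coeff (pderiv (pderiv p)) i = coeff 0 i"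
    by (simp only: coeff_pderiv coeff_0)
qed

text \<open>In characteristic two, the second condition divided by \<open>f^2\<close> reads
  \<open>(u/f)' = (b/f)^2\<close>.\<close>

definition square_form_datum :: "'a::field poly \<Rightarrow> 'a poly \<Rightarrow> 'a poly \<Rightarrow> bool" where
  "square_form_datum f u b \<longleftrightarrow> comaximal u f \<and> pderiv (u * f) = b\<^sup>2"

text \<open>The new pair comes from the fractions \<open>u/f + v/g\<close> and
  \<open>b/f + c/g\<close>; differentiation and squaring are both additive. Modulo \<open>f\<close>
  only \<open>b * g\<close> is left of the new \<open>b\<close>, which gives the divisibility
  claim.\<close>

lemma square_form_datum_mult:
  fixes f g :: "'a::field poly"
  assumes char: "CHAR('a) = 2" and fg: "comaximal f g"
    and f: "square_form_datum f u b" and g: "square_form_datum g v c"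
  shows "square_form_datum (f * g) (u * g + v * f) (b * g + c * f)"
    and "f * g dvd b * g + c * f \<Longrightarrow> f dvd b \<and> g dvd c"
proof -
  have gf: "comaximal g f" using fg comaximal_commute by blast
  have "comaximal (u * g + v * f) f"
    unfolding comaximal_add_mult using f gf
    by (auto simp: square_form_datum_def intro: comaximal_mult_left)
  moreover have "comaximal (v * f + u * g) g"
    unfolding comaximal_add_mult using g fg
    by (auto simp: square_form_datum_def intro: comaximal_mult_left)
  ultimately have "comaximal (u * g + v * f) (f * g)"
    by (simp add: comaximal_mult_right add.commute)
  moreover have "pderiv ((u * g + v * f) * (f * g)) = (b * g + c * f)\<^sup>2"
  proof -
    have "(u * g + v * f) * (f * g) = g\<^sup>2 * (u * f) + f\<^sup>2 * (v * g)"
      by (simp add: power2_eq_square algebra_simps)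
    then have "pderiv ((u * g + v * f) * (f * g)) = g\<^sup>2 * b\<^sup>2 + f\<^sup>2 * c\<^sup>2"
      using f g by (simp add: pderiv_add char_two_pderiv_square_mult[OF char] square_form_datum_def)
    also have "\<dots> = (b * g + c * f)\<^sup>2"
      using char by (subst char_two_power2_add) (simp_all add: power_mult_distrib mult.commute)
    finally show ?thesis .
  qed
  ultimately show "square_form_datum (f * g) (u * g + v * f) (b * g + c * f)"
    by (simp add: square_form_datum_def)
  assume dvd: "f * g dvd b * g + c * f"
  then have "f dvd b * g + c * f" "g dvd b * g + c * f"
    by (meson dvd_mult_left dvd_mult_right)+
  then have "f dvd g * b" "g dvd f * c"
    by (simp_all add: dvd_add_left_iff dvd_add_right_iff mult.commute)
  then show "f dvd b \<and> g dvd c" using fg gf comaximal_dvd_mult_cancel by blast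
qed

lemma power_dvd_power_imp_le_degree:
  fixes p :: "'a::field poly"
  assumes "degree p > 0" "p ^ i dvd p ^ j"
  shows "i \<le> j"
proof -
  from assms(1) have "p \<noteq> 0" by auto
  with dvd_imp_degree_le[OF assms(2)] assms(1) show ?thesis by (simp add: degree_power_eq)
qed

text \<open>The square \<open>(p ^ r)^2\<close> can be pulled out of the derivative. For even
  \<open>e\<close> it remains to use \<open>(X + a)' = 1\<close>; for odd \<open>e\<close> one more
  factor \<open>p\<close> is left, and \<open>u = p'\<close> gives \<open>(u p)' = p'^2\<close>,
  while \<open>u = 1 + X p\<close> gives \<open>(u p)' = p^2\<close> if
  \<open>p' = 0\<close>.\<close>

lemma irreducible_power_square_form_datum:
  fixes p :: "'a::field poly"
  assumes char: "CHAR('a) = 2" and p: "irreducible p" and e: "e > 1 \<or> e = 1 \<and> pderiv p \<noteq> 0"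
  shows "\<exists>u b. square_form_datum (p ^ e) u b \<and> \<not> p ^ e dvd b"
proof -
  note deg = degree_pos_if_irreducible[OF p]
  from deg have p0: "p \<noteq> 0" by auto
  define r where "r = e div 2"
  consider "even e" | "odd e" "pderiv p \<noteq> 0" | "odd e" "pderiv p = 0" by blast
  then show ?thesis
  proof cases
    case 1
    then have er: "p ^ e = (p ^ r)\<^sup>2" by (simp add: r_def power_mult[symmetric])
    have r: "r > 0" "e > r" using 1 e by (auto simp: r_def)
    \<comment> \<open>A \<open>p\<close> dividing every \<open>X + a\<close> would divide
      \<open>(X + 1) - X = 1\<close>.\<close>
    have "\<exists>a. \<not> p dvd [:a, 1:]"
    proof (rule ccontr)
      assume "\<not> ?thesis"
      then have "p dvd [:1, 1:] - [:0, 1:]" by (intro dvd_diff) auto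
      then show False using p by (simp add: Factorial_Ring.irreducible_def one_pCons)
    qed
    then obtain a where "\<not> p dvd [:a, 1:]" by blast
    then have "comaximal p [:a, 1:]" by (rule irreducible_imp_comaximal[OF p])
    then have "comaximal [:a, 1:] (p ^ e)"
      by (simp add: comaximal_commute[of p] comaximal_power_right)
    moreover have "pderiv ([:a, 1:] * p ^ e) = (p ^ r)\<^sup>2"
      using char_two_pderiv_square_mult[OF char, of "p ^ r" "[:a, 1:]"]
      unfolding er by (subst mult.commute) (simp add: pderiv_pCons)
    moreover have "\<not> p ^ e dvd p ^ r" using power_dvd_power_imp_le_degree[OF deg, of e r] r by linarith
    ultimately show ?thesis unfolding square_form_datum_def by blast
  next
    case 2
    have er: "p ^ e = (p ^ r)\<^sup>2 * p"
      using 2(1) unfolding r_def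
      by (metis odd_two_times_div_two_succ power_add power_mult power_one_right mult.commute)
    have co: "comaximal p (pderiv p)" by (rule irreducible_comaximal_pderiv[OF p 2(2)])
    then have "comaximal (pderiv p) (p ^ e)"
      by (simp add: comaximal_commute[of p] comaximal_power_right)
    moreover have "pderiv (pderiv p * p ^ e) = (p ^ r * pderiv p)\<^sup>2"
    proof -
      have "pderiv p * p ^ e = (p ^ r)\<^sup>2 * (pderiv p * p)" by (simp add: er)
      then have "pderiv (pderiv p * p ^ e) = (p ^ r)\<^sup>2 * pderiv (pderiv p * p)"
        by (simp only: char_two_pderiv_square_mult[OF char])
      also have "pderiv (pderiv p * p) = (pderiv p)\<^sup>2"
        by (simp add: pderiv_mult char_two_pderiv_pderiv[OF char] power2_eq_square)
      finally show ?thesis by (simp add: power_mult_distrib)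
    qed
    moreover have "\<not> p ^ e dvd p ^ r * pderiv p"
    proof
      assume "p ^ e dvd p ^ r * pderiv p"
      then have "p ^ r * (p ^ r * p) dvd p ^ r * pderiv p"
        by (simp only: er power2_eq_square mult.assoc)
      then have "p dvd pderiv p" using p0 by (auto dest: dvd_mult_right)
      then have "p dvd pderiv p * 1" by simp
      with co have "p dvd 1" by (rule comaximal_dvd_mult_cancel)
      with p show False by (simp add: Factorial_Ring.irreducible_def)
    qed
    ultimately show ?thesis unfolding square_form_datum_def by blast
  next
    case 3
    have er: "p ^ e = (p ^ r)\<^sup>2 * p"
      using 3(1) unfolding r_def
      by (metis odd_two_times_div_two_succ power_add power_mult power_one_right mult.commute)
    \<comment> \<open>Since \<open>e = 1\<close> is excluded, \<open>r\<close> is positive; for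
      \<open>r = 0\<close> the witness \<open>b = p ^ (r + 1)\<close> would be a multiple of
      \<open>p ^ e\<close>.\<close>
    have r: "r > 0" "e > r + 1" using 3 e by (auto simp: r_def elim!: oddE)
    let ?u = "1 + [:0, 1:] * p"
    have "comaximal ?u p" by (simp only: comaximal_add_mult comaximal_1_left)
    then have "comaximal ?u (p ^ e)" by (rule comaximal_power_right)
    moreover have "pderiv (?u * p ^ e) = (p ^ (r + 1))\<^sup>2"
    proof -
      have "?u * p ^ e = (p ^ r)\<^sup>2 * (?u * p)" by (simp only: er mult_ac)
      then have "pderiv (?u * p ^ e) = (p ^ r)\<^sup>2 * pderiv (?u * p)"
        by (simp only: char_two_pderiv_square_mult[OF char])
      also have "pderiv (?u * p) = p\<^sup>2"
        by (simp add: pderiv_mult pderiv_add pderiv_pCons 3(2) power2_eq_square)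
      finally show ?thesis by (simp add: power_mult_distrib)
    qed
    moreover have "\<not> p ^ e dvd p ^ (r + 1)" using power_dvd_power_imp_le_degree[OF deg, of e "r + 1"] r by linarith
    ultimately show ?thesis unfolding square_form_datum_def by blast
  qed
qed

lemma exists_maximal_power_factor:
  fixes p f :: "'a::field poly"
  assumes "degree p > 0" "f \<noteq> 0"
  shows "\<exists>e g. f = p ^ e * g \<and> \<not> p dvd g"
  using assms(2)
proof (induction "degree f" arbitrary: f rule: less_induct)
  case less
  show ?case
  proof (cases "p dvd f")
    case True
    then obtain h where h: "f = p * h" by blast
    with less.prems have "p \<noteq> 0" "h \<noteq> 0" by auto
    then have "degree h < degree f" using assms(1) by (simp add: h degree_mult_eq)
    from less.hyps[OF this \<open>h \<noteq> 0\<close>] obtain e g where "h = p ^ e * g" "\<not> p dvd g" by blast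
    then have "f = p ^ Suc e * g" "\<not> p dvd g" by (simp_all add: h)
    then show ?thesis by blast
  next
    case False
    then show ?thesis by (intro exI[of _ 0] exI[of _ f]) simp
  qed
qed

text \<open>Split off the full power of one irreducible factor at a time. Then
  \<open>f dvd b\<close> forces the same divisibility for each prime power factor, which is possible
  only for inseparable irreducible ones.\<close>

lemma exists_square_form_datum:
  fixes f :: "'a::field poly"
  assumes char: "CHAR('a) = 2" and monic: "lead_coeff f = 1"
  shows "\<exists>u b. square_form_datum f u b \<and> (f dvd b \<longrightarrow> distinct_inseparable_product f)"
  using monic
proof (induction "degree f" arbitrary: f rule: less_induct)
  case less
  show ?case
  proof (cases "degree f = 0")
    case True
    with less.prems have f: "f = 1" by (auto elim!: degree_eq_zeroE simp: one_pCons)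
    \<comment> \<open>\<open>1\<close> divides every \<open>b\<close>, so the base case relies on
      the empty product.\<close>
    have "distinct_inseparable_product f"
      unfolding distinct_inseparable_product_def f by (rule exI[of _ "{}"]) simp
    moreover have "square_form_datum f 1 0" by (simp add: square_form_datum_def f)
    ultimately show ?thesis by blast
  next
    case False
    then obtain p where p: "irreducible p" "lead_coeff p = 1" "p dvd f"
      using exists_monic_irreducible_factor by blast
    have f0: "f \<noteq> 0" using less.prems by auto
    have deg: "degree p > 0" by (rule degree_pos_if_irreducible[OF p(1)])
    from exists_maximal_power_factor[OF deg f0]
    obtain e g where g: "f = p ^ e * g" "\<not> p dvd g" by blast
    have e: "e > 0" using g p(3) by (cases e) auto
    have p0: "p \<noteq> 0" and g0: "g \<noteq> 0" using deg g(2) by auto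
    have "lead_coeff g = 1" using less.prems p(2) by (simp add: g(1) lead_coeff_mult lead_coeff_power)
    moreover have "degree g < degree f"
      using p0 g0 deg e by (simp add: g(1) degree_mult_eq degree_power_eq)
    ultimately obtain v c where vc: "square_form_datum g v c" "g dvd c \<Longrightarrow> distinct_inseparable_product g"
      using less.hyps by blast
    have co: "comaximal (p ^ e) g"
      using irreducible_imp_comaximal[OF p(1) g(2)] comaximal_power_right comaximal_commute by metis
    note mult = square_form_datum_mult[OF char co _ vc(1), folded g(1)]
    show ?thesis
    proof (cases "e > 1 \<or> e = 1 \<and> pderiv p \<noteq> 0")
      case True
      from irreducible_power_square_form_datum[OF char p(1) this] obtain u b
        where "square_form_datum (p ^ e) u b" "\<not> p ^ e dvd b" by blast
      with mult[of u b] show ?thesis by blast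
    next
      case False
      with e have e1: "e = 1" and dp: "pderiv p = 0" by auto
      \<comment> \<open>Since \<open>0\<close> is divisible by \<open>p\<close>, the cofactor
        \<open>g\<close> alone decides whether \<open>f\<close> divides the combined
        \<open>b\<close>.\<close>
      have "square_form_datum (p ^ e) 1 0" by (simp add: square_form_datum_def e1 dp)
      note mult = mult[OF this]
      have "distinct_inseparable_product f" if "g dvd c"
      proof -
        from vc(2)[OF that] obtain S where S: "finite S" "g = \<Prod>S"
          "\<forall>p\<in>S. lead_coeff p = 1 \<and> irreducible p \<and> \<not> separable_poly p"
          unfolding distinct_inseparable_product_def by blast
        have "p \<notin> S" using g(2) S by auto
        then have "f = \<Prod>(insert p S)" using S by (simp add: g(1) e1)
        moreover have "\<not> separable_poly p" using dp irreducible_separable_iff_pderiv[OF p(1)] by simp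
        ultimately show ?thesis
          unfolding distinct_inseparable_product_def using S p
          by (intro exI[of _ "insert p S"]) auto
      qed
      with mult show ?thesis by blast
    qed
  qed
qed

section \<open>The top coefficient functional\<close>

text \<open>For monic \<open>f\<close> this is the coefficient of \<open>1/X\<close> in the
  expansion of \<open>p/f\<close> at infinity.\<close>

definition top_coeff :: "'a::field poly \<Rightarrow> 'a poly \<Rightarrow> 'a" where
  "top_coeff f p = coeff (p mod f) (degree f - 1)"

lemma top_coeff_add: "top_coeff f (p + q) = top_coeff f p + top_coeff f q"
  by (simp add: top_coeff_def poly_mod_add_left)

lemma top_coeff_smult: "top_coeff f (smult c p) = c * top_coeff f p"
  by (simp add: top_coeff_def mod_smult_left)

lemma top_coeff_eq_0_if_dvd: "f dvd p \<Longrightarrow> top_coeff f p = 0"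
  by (simp add: top_coeff_def dvd_imp_mod_0)

text \<open>A suitable power of \<open>X\<close> moves the leading coefficient of a nonzero
  remainder to degree \<open>degree f - 1\<close>, where no reduction modulo \<open>f\<close>
  occurs.\<close>

lemma top_coeff_nondegenerate:
  fixes f p :: "'a::field poly"
  assumes deg: "degree f > 0" and zero: "\<And>q. top_coeff f (p * q) = 0"
  shows "f dvd p"
proof (rule ccontr)
  assume "\<not> f dvd p"
  define r where "r = p mod f"
  have r0: "r \<noteq> 0" using \<open>\<not> f dvd p\<close> by (simp add: r_def dvd_eq_mod_eq_0)
  have degr: "degree r < degree f" using deg r0 unfolding r_def by (intro degree_mod_less') auto
  define k where "k = degree f - 1 - degree r"
  have "degree (r * monom 1 k) = degree f - 1"
    using r0 degr by (simp add: degree_mult_eq degree_monom_eq k_def)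
  then have "(r * monom 1 k) mod f = r * monom 1 k" using deg by (intro mod_poly_less) simp
  moreover have "(p * monom 1 k) mod f = (r * monom 1 k) mod f" by (simp add: r_def mod_mult_left_eq)
  ultimately have "top_coeff f (p * monom 1 k) = coeff (r * monom 1 k) (degree f - 1)"
    by (simp add: top_coeff_def)
  also have "\<dots> = lead_coeff r"
    using degr by (subst mult.commute) (simp add: coeff_monom_mult k_def)
  finally show False using zero r0 by simp
qed

lemma coeff_mult_degree_bounds:
  fixes p q :: "'a::comm_semiring_0 poly"
  assumes "degree p \<le> a" "degree q \<le> b"
  shows "coeff (p * q) (a + b) = coeff p a * coeff q b"
proof (cases "degree p = a \<and> degree q = b")
  case True
  then show ?thesis using coeff_mult_degree_sum[of p q] by auto
next
  case False
  with assms have *: "degree p < a \<or> degree q < b" by auto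
  with assms have "degree (p * q) < a + b"
    by (intro le_less_trans[OF degree_mult_le]) auto
  with * show ?thesis by (auto simp: coeff_eq_0)
qed

text \<open>Writing \<open>u x\<^sup>2 = Q f + R\<close> and \<open>b x = q f + r\<close>, differentiation of \<open>u f x\<^sup>2 = Q f\<^sup>2 + R f\<close> gives
  \<open>Q' f\<^sup>2 + (R f)' = q\<^sup>2 f\<^sup>2 + r\<^sup>2\<close>. By degrees \<open>(R f)' = r\<^sup>2\<close>; compare the coefficients of \<open>X\<^bsup>2n-2\<^esup>\<close>.\<close>

lemma top_coeff_square:
  fixes f :: "'a::field poly"
  assumes char: "CHAR('a) = 2" and deg: "degree f > 0" and monic: "lead_coeff f = 1"
    and ub: "square_form_datum f u b"
  shows "top_coeff f (u * (x * x)) = (top_coeff f (b * x))\<^sup>2"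
proof -
  define n where "n = degree f"
  have charp: "CHAR('a poly) = 2" using char by simp
  from deg have f0: "f \<noteq> 0" by auto
  define Q R q r where "Q = (u * x\<^sup>2) div f" and "R = (u * x\<^sup>2) mod f"
    and "q = (b * x) div f" and "r = (b * x) mod f"
  have QR: "u * x\<^sup>2 = Q * f + R" and qr: "b * x = q * f + r"
    by (simp_all add: Q_def R_def q_def r_def)
  have degR: "degree R \<le> n - 1" and degr: "degree r \<le> n - 1"
    using degree_mod_less[OF f0, of "u * x\<^sup>2"] degree_mod_less[OF f0, of "b * x"] deg
    by (auto simp: n_def R_def r_def)
  have "x\<^sup>2 * (u * f) = f\<^sup>2 * Q + R * f" using QR by (simp add: power2_eq_square algebra_simps)
  then have "x\<^sup>2 * pderiv (u * f) = f\<^sup>2 * pderiv Q + pderiv (R * f)"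
    by (metis char_two_pderiv_square_mult[OF char] pderiv_add)
  then have "(b * x)\<^sup>2 = f\<^sup>2 * pderiv Q + pderiv (R * f)"
    using ub by (simp add: square_form_datum_def power_mult_distrib mult.commute)
  moreover have "(b * x)\<^sup>2 = f\<^sup>2 * q\<^sup>2 + r\<^sup>2"
    by (simp add: qr char_two_power2_add[OF charp] power_mult_distrib mult.commute)
  ultimately have eq: "pderiv (R * f) - r\<^sup>2 = f\<^sup>2 * (q\<^sup>2 - pderiv Q)" by (simp add: algebra_simps)
  have "degree (R * f) \<le> 2 * n - 1"
    using degree_mult_le[of R f] degR deg unfolding n_def by linarith
  then have "degree (pderiv (R * f)) \<le> 2 * n - 2"
    by (intro degree_le) (auto simp: coeff_pderiv intro!: coeff_eq_0)
  moreover have "degree (r\<^sup>2) \<le> 2 * n - 2" using degree_power_le[of r 2] degr by linarith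
  ultimately have "degree (f\<^sup>2 * (q\<^sup>2 - pderiv Q)) \<le> 2 * n - 2"
    unfolding eq[symmetric] by (rule degree_diff_le)
  then have "q\<^sup>2 - pderiv Q = 0"
    using deg f0 by (cases "q\<^sup>2 - pderiv Q = 0") (simp_all add: degree_mult_eq degree_power_eq n_def)
  with eq have eq: "pderiv (R * f) = r\<^sup>2" by simp
  \<comment> \<open>Differentiation multiplies the coefficient of \<open>X^(2n-1)\<close> by the odd
    number \<open>2n - 1\<close>, which is \<open>1\<close> in the field.\<close>
  have "(n - 1) + n = Suc (2 * (n - 1))" using deg by (simp add: n_def)
  moreover have "of_nat (Suc (2 * (n - 1))) = (1::'a)"
  proof -
    have "of_nat (2 * (n - 1)) = (0::'a)" unfolding of_nat_eq_0_iff_char_dvd char by simp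
    then show ?thesis by (simp only: of_nat_Suc add_0_right)
  qed
  ultimately have "coeff (pderiv (R * f)) (2 * (n - 1)) = coeff (R * f) ((n - 1) + n)"
    by (simp only: coeff_pderiv mult_1)
  also have "\<dots> = coeff R (n - 1) * coeff f n"
    using degR by (intro coeff_mult_degree_bounds) (simp_all add: n_def)
  finally have "coeff R (n - 1) = coeff (r\<^sup>2) (2 * (n - 1))"
    using monic eq by (simp add: n_def)
  also have "\<dots> = (coeff r (n - 1))\<^sup>2"
    using coeff_mult_degree_bounds[OF degr degr] by (simp add: power2_eq_square mult_2)
  finally show ?thesis by (simp add: top_coeff_def R_def r_def n_def power2_eq_square)
qed

section \<open>Polynomials as a vector space with the monomials as basis\<close>

lemma vector_space_smult: "vector_space (smult :: 'a::field \<Rightarrow> 'a poly \<Rightarrow> 'a poly)"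
  by unfold_locales (simp_all add: smult_add_right smult_add_left)

interpretation poly_vs: vector_space "smult :: 'a::field \<Rightarrow> 'a poly \<Rightarrow> 'a poly"
  by (rule vector_space_smult)

lemma degree_less_in_span_monom:
  fixes p :: "'a::field poly"
  assumes "degree p < n"
  shows "p \<in> poly_vs.span (monom 1 ` {..<n})"
proof -
  have "(\<Sum>i\<le>degree p. smult (coeff p i) (monom 1 i)) \<in> poly_vs.span (monom 1 ` {..<n})"
    using assms by (intro poly_vs.span_sum poly_vs.span_scale poly_vs.span_base) auto
  then show ?thesis by (simp add: smult_monom poly_as_sum_of_monoms)
qed

lemma independent_monom:
  "poly_vs.independent (monom (1::'a::field) ` I)"
  unfolding poly_vs.dependent_def
proof clarify
  fix i assume i: "monom (1::'a) i \<in> poly_vs.span (monom 1 ` I - {monom 1 i})"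
  have "poly_vs.span (monom (1::'a) ` I - {monom 1 i}) \<subseteq> {y. coeff y i = 0}"
    by (rule poly_vs.span_minimal) (auto simp: poly_vs.subspace_def)
  with i show False by auto
qed

lemma card_monom_image: "card (monom (1::'a::field) ` {..<n}) = n"
  by (subst card_image) (auto simp: inj_on_def monom_eq_iff')

section \<open>Orthonormal bases\<close>

text \<open>A functional killing the multiples of \<open>f\<close> stands for a linear form on
  \<open>k[X]/(f)\<close>; with the last assumption it is a Frobenius form.\<close>

locale frobenius_functional =
  fixes f :: "'a::field poly" and \<phi> :: "'a poly \<Rightarrow> 'a"
  assumes degree_pos: "degree f > 0"
    and add: "\<phi> (p + q) = \<phi> p + \<phi> q"
    and smult: "\<phi> (smult c p) = c * \<phi> p"
    and eq_0_if_dvd: "f dvd p \<Longrightarrow> \<phi> p = 0"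
    and nondegenerate: "(\<And>q. \<phi> (p * q) = 0) \<Longrightarrow> f dvd p"
begin

lemma zero [simp]: "\<phi> 0 = 0"
  by (rule eq_0_if_dvd) simp

lemma diff: "\<phi> (p - q) = \<phi> p - \<phi> q"
  using add[of "p - q" q] by simp

lemma sum: "\<phi> (\<Sum>i\<in>I. g i) = (\<Sum>i\<in>I. \<phi> (g i))"
  by (induction I rule: infinite_finite_induct) (simp_all add: add)

lemma mult_mod: "\<phi> (p * (q mod f)) = \<phi> (p * q)"
proof -
  have "p * q = p * (q mod f) + f * (p * (q div f))"
    by (metis add.commute distrib_left mult.left_commute mult_div_mod_eq)
  then show ?thesis by (simp add: add eq_0_if_dvd)
qed

lemma mult_add_add: "\<phi> ((a + b) * (c + d)) = \<phi> (a * c) + \<phi> (a * d) + (\<phi> (b * c) + \<phi> (b * d))"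
  by (simp only: distrib_left distrib_right add ac_simps)

lemma degree_mod: "degree (p mod f) < degree f"
proof -
  have "f \<noteq> 0" using degree_pos by auto
  from degree_mod_less[OF this, of p] show ?thesis using degree_pos by auto
qed

text \<open>The degree bound selects reduced representatives, so dimensions can be counted among
  polynomials.\<close>

definition orthonormal :: "(nat \<Rightarrow> 'a poly) \<Rightarrow> nat \<Rightarrow> bool" where
  "orthonormal x r \<longleftrightarrow> (\<forall>i<r. degree (x i) < degree f) \<and>
     (\<forall>i<r. \<forall>j<r. \<phi> (x i * x j) = (if i = j then 1 else 0))"

definition projection :: "(nat \<Rightarrow> 'a poly) \<Rightarrow> nat \<Rightarrow> 'a poly \<Rightarrow> 'a poly" where
  "projection x r v = (\<Sum>j<r. smult (\<phi> (v * x j)) (x j))"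

lemma mult_projection: "\<phi> (w * projection x r v) = (\<Sum>j<r. \<phi> (v * x j) * \<phi> (w * x j))"
  by (simp add: projection_def sum_distrib_left sum smult)

lemma residual_orthogonal:
  assumes "orthonormal x r" "i < r"
  shows "\<phi> ((v - projection x r v) * x i) = 0"
proof -
  have "\<phi> (x i * projection x r v) = (\<Sum>j<r. if i = j then \<phi> (v * x j) else 0)"
    unfolding mult_projection using assms by (intro sum.cong) (auto simp: orthonormal_def)
  also have "\<dots> = \<phi> (v * x i)" using assms by simp
  finally show ?thesis by (simp add: mult.commute[of _ "x i"] right_diff_distrib diff)
qed

lemma degree_projection_less:
  assumes "orthonormal x r"
  shows "degree (projection x r v) < degree f"
  unfolding projection_def using assms degree_pos
  by (intro degree_sum_less) (auto simp: orthonormal_def intro: le_less_trans[OF degree_smult_le])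

text \<open>Residuals are orthogonal to the family. If all of them were multiples of
  \<open>f\<close>, those of the low monomials would vanish by degree, and \<open>r\<close> vectors
  would span a space of larger dimension.\<close>

lemma orthonormal_incomplete:
  assumes x: "orthonormal x r" and r: "r < degree f"
  shows "\<exists>v. \<not> f dvd v \<and> (\<forall>i<r. \<phi> (v * x i) = 0)"
proof (rule ccontr)
  assume *: "\<not> ?thesis"
  have "monom 1 ` {..<degree f} \<subseteq> poly_vs.span (x ` {..<r})"
  proof clarify
    fix k assume k: "k < degree f"
    let ?v = "monom 1 k :: 'a poly"
    have "f dvd ?v - projection x r ?v" using * residual_orthogonal[OF x] by blast
    moreover have "degree (?v - projection x r ?v) < degree f"
      using k degree_projection_less[OF x] by (intro degree_diff_less) (simp_all add: degree_monom_eq)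
    ultimately have "?v - projection x r ?v = 0" using dvd_imp_degree_le by (metis leD)
    then have "?v = projection x r ?v" by simp
    also have "\<dots> \<in> poly_vs.span (x ` {..<r})"
      unfolding projection_def by (intro poly_vs.span_sum poly_vs.span_scale poly_vs.span_base) auto
    finally show "?v \<in> poly_vs.span (x ` {..<r})" .
  qed
  from poly_vs.independent_span_bound[OF _ independent_monom this]
  have "degree f \<le> card (x ` {..<r})" by (simp add: card_monom_image)
  also have "\<dots> \<le> r" using card_image_le[of "{..<r}" x] by simp
  finally show False using r by simp
qed

lemma orthonormal_independent:
  assumes x: "orthonormal x r"
  shows "poly_vs.independent (x ` {..<r})" and "card (x ` {..<r}) = r"
proof -
  have inj: "inj_on x {..<r}"
  proof (rule inj_onI)
    fix i j assume ij: "i \<in> {..<r}" "j \<in> {..<r}" "x i = x j"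
    have "\<phi> (x i * x j) = (if i = j then 1 else 0)" "\<phi> (x i * x i) = 1"
      using x ij(1,2) unfolding orthonormal_def by simp_all
    with ij(3) show "i = j" by (auto split: if_splits)
  qed
  then show "card (x ` {..<r}) = r" by (simp add: card_image)
  show "poly_vs.independent (x ` {..<r})"
    unfolding poly_vs.dependent_def
  proof clarify
    fix i assume i: "i < r" "x i \<in> poly_vs.span (x ` {..<r} - {x i})"
    have "poly_vs.span (x ` {..<r} - {x i}) \<subseteq> {y. \<phi> (y * x i) = 0}"
    proof (rule poly_vs.span_minimal)
      show "x ` {..<r} - {x i} \<subseteq> {y. \<phi> (y * x i) = 0}"
        using x i(1) by (auto simp: orthonormal_def)
      show "poly_vs.subspace {y. \<phi> (y * x i) = 0}"
        by (auto simp: poly_vs.subspace_def distrib_right add smult)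
    qed
    with i x show False by (auto simp: orthonormal_def)
  qed
qed

text \<open>By dimension the reduced residual lies in the span of the family, where
  \<open>projection\<close> is the identity; being orthogonal to the family, it is also projected to
  \<open>0\<close>.\<close>

lemma orthonormal_complete:
  assumes x: "orthonormal x (degree f)"
  shows "f dvd v - projection x (degree f) v"
proof -
  let ?n = "degree f"
  let ?w = "(v - projection x ?n v) mod f"
  have w: "\<phi> (x i * ?w) = 0" if "i < ?n" for i
    unfolding mult_mod using residual_orthogonal[OF x that, of v] by (simp only: mult.commute)
  have "?w \<in> poly_vs.span (x ` {..<?n})"
  proof (rule ccontr)
    assume nin: "?w \<notin> poly_vs.span (x ` {..<?n})"
    then have "poly_vs.independent (insert ?w (x ` {..<?n}))"
      using orthonormal_independent(1)[OF x] by (rule poly_vs.independent_insertI)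
    moreover have "insert ?w (x ` {..<?n}) \<subseteq> poly_vs.span (monom 1 ` {..<?n})"
      using x degree_mod by (auto simp: orthonormal_def intro: degree_less_in_span_monom)
    ultimately have "card (insert ?w (x ` {..<?n})) \<le> card (monom (1::'a) ` {..<?n})"
      using poly_vs.independent_span_bound by blast
    then have "card (insert ?w (x ` {..<?n})) \<le> ?n" by (simp only: card_monom_image)
    moreover have "?w \<notin> x ` {..<?n}" using nin by (meson poly_vs.span_base)
    ultimately show False using orthonormal_independent(2)[OF x] by simp
  qed
  moreover have "poly_vs.span (x ` {..<?n}) \<subseteq> {y. y = projection x ?n y}"
  proof (rule poly_vs.span_minimal)
    have "projection x ?n (x i) = (\<Sum>j<?n. if i = j then x j else 0)" if "i < ?n" for i
      unfolding projection_def using x that by (intro sum.cong) (auto simp: orthonormal_def)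
    then show "x ` {..<?n} \<subseteq> {y. y = projection x ?n y}" by auto
    have "projection x ?n (y + z) = projection x ?n y + projection x ?n z" for y z
      by (simp add: projection_def distrib_right add smult_add_left sum.distrib)
    moreover have "projection x ?n (smult c y) = smult c (projection x ?n y)" for c y
      by (simp add: projection_def smult poly_vs.scale_sum_right)
    ultimately show "poly_vs.subspace {y. y = projection x ?n y}"
      unfolding poly_vs.subspace_def by (auto simp: projection_def)
  qed
  ultimately have "?w = projection x ?n ?w" by blast
  also have "\<dots> = 0" using w by (simp add: projection_def mult.commute)
  finally show ?thesis by (simp add: dvd_eq_mod_eq_0)
qed

lemma parseval:
  assumes "orthonormal x (degree f)"
  shows "(\<Sum>j<degree f. \<phi> (v * x j) * \<phi> (w * x j)) = \<phi> (v * w)"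
proof -
  have "f dvd w * (v - projection x (degree f) v)"
    using orthonormal_complete[OF assms] by simp
  then have "\<phi> (w * v - w * projection x (degree f) v) = 0"
    by (intro eq_0_if_dvd) (simp add: right_diff_distrib)
  then show ?thesis by (simp add: diff mult_projection mult.commute)
qed

lemma orthonormal_extend:
  assumes x: "orthonormal x r" and y: "\<And>i. i < r \<Longrightarrow> \<phi> (y * x i) = 0" "\<phi> (y * y) = 1"
  shows "orthonormal (x(r := y mod f)) (Suc r)"
proof -
  have *: "\<phi> (x i * (y mod f)) = 0" if "i < r" for i
    unfolding mult_mod using y(1)[OF that] by (simp only: mult.commute)
  moreover have "\<phi> (y mod f * x i) = 0" if "i < r" for i
    using *[OF that] by (simp only: mult.commute)
  moreover have "\<phi> (y mod f * (y mod f)) = 1"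
    using y(2) mult_mod[of y y] mult_mod[of "y mod f" y] by (simp add: mult.commute)
  ultimately show ?thesis using x degree_mod by (auto simp: orthonormal_def less_Suc_eq)
qed

text \<open>The induction keeps a non-isotropic vector in the orthogonal complement. If the complement of
  the new unit vector \<open>y\<close> is alternating, a hyperbolic pair \<open>z, w\<close> in it allows \<open>y\<close> to be replaced by
  \<open>y + z\<close>, whose complement contains the unit vector \<open>y + w\<close>.\<close>

lemma exists_orthonormal:
  assumes char: "CHAR('a) = 2"
    and square: "\<And>x. \<exists>c. \<phi> (x * x) = c\<^sup>2" and nonalternating: "\<phi> (y0 * y0) \<noteq> 0"
  shows "\<exists>x. orthonormal x (degree f)"
proof -
  have "\<exists>x. orthonormal x r \<and>
      (r < degree f \<longrightarrow> (\<exists>y. (\<forall>i<r. \<phi> (y * x i) = 0) \<and> \<phi> (y * y) \<noteq> 0))" if "r \<le> degree f" for r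
    using that
  proof (induction r)
    case 0
    show ?case using nonalternating by (auto simp: orthonormal_def)
  next
    case (Suc r)
    then obtain x y' where x: "orthonormal x r" and y': "\<forall>i<r. \<phi> (y' * x i) = 0" "\<phi> (y' * y') \<noteq> 0"
      by auto
    obtain c where c: "\<phi> (y' * y') = c\<^sup>2" using square by blast
    define y where "y = smult (1 / c) y'"
    have y: "\<phi> (y * x i) = 0" if "i < r" for i using y' that by (simp add: y_def smult)
    have yy: "\<phi> (y * y) = 1" using c y'(2) by (simp add: y_def smult power2_eq_square)
    define x1 where "x1 = x(r := y mod f)"
    have x1: "orthonormal x1 (Suc r)" unfolding x1_def by (rule orthonormal_extend[OF x y yy])
    have x1_orth: "(\<forall>i<Suc r. \<phi> (w * x1 i) = 0) \<longleftrightarrow> (\<forall>i<r. \<phi> (w * x i) = 0) \<and> \<phi> (w * y) = 0" for w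
      by (auto simp: x1_def less_Suc_eq mult_mod)
    show ?case
    proof (cases "Suc r < degree f \<longrightarrow> (\<exists>w. (\<forall>i<Suc r. \<phi> (w * x1 i) = 0) \<and> \<phi> (w * w) \<noteq> 0)")
      case True
      with x1 show ?thesis by blast
    next
      case False
      then have r: "Suc r < degree f" and alt: "\<And>w. \<forall>i<Suc r. \<phi> (w * x1 i) = 0 \<Longrightarrow> \<phi> (w * w) = 0"
        by auto
      from orthonormal_incomplete[OF x1 r] obtain z where
        z: "\<not> f dvd z" "\<forall>i<Suc r. \<phi> (z * x1 i) = 0" by blast
      obtain v where v: "\<phi> (z * v) \<noteq> 0" using z(1) nondegenerate by blast
      \<comment> \<open>As \<open>z\<close> is orthogonal to the family, removing the projection of
        \<open>v\<close> keeps its pairing with \<open>z\<close>, and scaling makes that pairing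
        \<open>1\<close>.\<close>
      define w where "w = smult (1 / \<phi> (z * v)) (v - projection x1 (Suc r) v)"
      have w: "\<forall>i<Suc r. \<phi> (w * x1 i) = 0"
        using residual_orthogonal[OF x1] by (simp add: w_def smult)
      have "\<phi> (z * projection x1 (Suc r) v) = 0"
        unfolding mult_projection by (rule sum.neutral) (use z(2) in auto)
      then have zw: "\<phi> (z * w) = 1" using v by (simp add: w_def smult right_diff_distrib diff)
      from alt[OF z(2)] alt[OF w] have iso: "\<phi> (z * z) = 0" "\<phi> (w * w) = 0" .
      from z(2) w have orth: "\<And>i. i < r \<Longrightarrow> \<phi> (z * x i) = 0" "\<phi> (z * y) = 0"
        "\<And>i. i < r \<Longrightarrow> \<phi> (w * x i) = 0" "\<phi> (w * y) = 0"
        unfolding x1_orth by auto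
      then have orth': "\<phi> (y * z) = 0" "\<phi> (y * w) = 0" "\<phi> (w * z) = 1"
        using zw by (simp_all only: mult.commute[of y] mult.commute[of w z])
      have "orthonormal (x(r := (y + z) mod f)) (Suc r)"
      proof (rule orthonormal_extend[OF x])
        show "\<phi> ((y + z) * x i) = 0" if "i < r" for i
          using that y orth by (simp add: distrib_right add)
        show "\<phi> ((y + z) * (y + z)) = 1"
          using yy iso orth orth' by (simp add: mult_add_add)
      qed
      moreover have "\<forall>i<Suc r. \<phi> ((y + w) * (x(r := (y + z) mod f)) i) = 0"
      proof -
        \<comment> \<open>Only \<open>\<phi> (y * y)\<close> and \<open>\<phi> (w * z)\<close>
          survive, and they cancel in characteristic two.\<close>
        have "\<phi> ((y + w) * (y + z)) = 1 + 1"
          using yy orth orth' by (simp add: mult_add_add)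
        then have "\<phi> ((y + w) * (y + z)) = 0" using char_two_add_self[OF char] by simp
        then show ?thesis using y orth by (auto simp: less_Suc_eq mult_mod distrib_right add)
      qed
      moreover have "\<phi> ((y + w) * (y + w)) \<noteq> 0"
        using yy iso orth orth' by (simp add: mult_add_add)
      ultimately show ?thesis by blast
    qed
  qed
  then show ?thesis by blast
qed

text \<open>\<open>M p\<close> is multiplication by \<open>p\<close> in the basis \<open>x\<close>:
  symmetric by commutativity, multiplicative by \<open>parseval\<close>, and zero exactly for
  multiples of \<open>f\<close>.\<close>

lemma exists_symmetric_matrix_if_orthonormal:
  assumes monic: "lead_coeff f = 1" and x: "orthonormal x (degree f)"
  shows "\<exists>A \<in> carrier_mat (degree f) (degree f). transpose_mat A = A \<and> is_minimal_polynomial A f"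
proof -
  let ?n = "degree f"
  define M where "M p = mat ?n ?n (\<lambda>(i, j). \<phi> (p * x i * x j))" for p
  have dim [simp]: "dim_row (M p) = ?n" "dim_col (M p) = ?n" for p by (simp_all add: M_def)
  have M_1: "M 1 = 1\<^sub>m ?n"
    using x by (intro eq_matI) (auto simp: M_def orthonormal_def)
  have M_mult: "M p * M q = M (p * q)" for p q
  proof (rule eq_matI)
    fix i j assume "i < dim_row (M (p * q))" "j < dim_col (M (p * q))"
    then have ij: "i < ?n" "j < ?n" by simp_all
    then have "(M p * M q) $$ (i, j) = (\<Sum>k<?n. \<phi> ((p * x i) * x k) * \<phi> (q * x k * x j))"
      by (simp add: M_def scalar_prod_def lessThan_atLeast0)
    also have "\<dots> = (\<Sum>k<?n. \<phi> ((p * x i) * x k) * \<phi> ((q * x j) * x k))"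
      by (simp add: mult_ac)
    also have "\<dots> = \<phi> ((p * x i) * (q * x j))" by (rule parseval[OF x])
    finally show "(M p * M q) $$ (i, j) = M (p * q) $$ (i, j)"
      using ij by (simp add: M_def mult_ac)
  qed simp_all
  define A where "A = M [:0, 1:]"
  have pow: "A ^\<^sub>m k = M (monom 1 k)" for k
  proof (induction k)
    case 0
    then show ?case by (simp add: A_def M_1)
  next
    case (Suc k)
    have "monom 1 k * [:0, 1:] = (monom 1 (Suc k) :: 'a poly)"
      by (simp add: monom_Suc mult.commute)
    with Suc show ?case by (simp add: A_def M_mult)
  qed
  have entry: "poly_mat p A = M p" for p
  proof (rule eq_matI)
    fix i j assume "i < dim_row (M p)" "j < dim_col (M p)"
    then have ij: "i < ?n" "j < ?n" by simp_all
    then have "poly_mat p A $$ (i, j) = (\<Sum>k\<le>degree p. coeff p k * \<phi> (monom 1 k * x i * x j))"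
      by (simp add: poly_mat_def pow) (simp add: A_def M_def)
    also have "\<dots> = (\<Sum>k\<le>degree p. \<phi> (monom (coeff p k) k * (x i * x j)))"
      by (intro sum.cong refl) (simp add: smult[symmetric] smult_monom mult.assoc flip: mult_smult_left)
    also have "\<dots> = \<phi> ((\<Sum>k\<le>degree p. monom (coeff p k) k) * (x i * x j))"
      by (simp only: sum sum_distrib_right)
    also have "\<dots> = M p $$ (i, j)" using ij by (simp add: poly_as_sum_of_monoms M_def mult.assoc)
    finally show "poly_mat p A $$ (i, j) = M p $$ (i, j)" .
  qed (simp_all add: poly_mat_def A_def)
  have "M p = 0\<^sub>m ?n ?n \<longleftrightarrow> f dvd p" for p
  proof
    assume "f dvd p"
    then show "M p = 0\<^sub>m ?n ?n" by (intro eq_matI) (auto simp: M_def intro!: eq_0_if_dvd)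
  next
    assume Mp: "M p = 0\<^sub>m ?n ?n"
    have *: "\<phi> (p * x i * x j) = 0" if "i < ?n" "j < ?n" for i j
    proof -
      have "M p $$ (i, j) = 0" using that by (simp add: Mp)
      then show ?thesis using that by (simp add: M_def)
    qed
    \<comment> \<open>\<open>parseval\<close> first replaces \<open>x j\<close> by an arbitrary
      \<open>q\<close>; below it replaces \<open>x i\<close> by \<open>1\<close>.\<close>
    have **: "\<phi> (p * q * x i) = 0" if "i < ?n" for i q
    proof -
      have "\<phi> ((p * x i) * q) = (\<Sum>j<?n. \<phi> (p * x i * x j) * \<phi> (q * x j))"
        by (rule parseval[OF x, symmetric])
      also have "\<dots> = 0" by (rule sum.neutral) (use * that in auto)
      finally show ?thesis by (simp add: mult_ac)
    qed
    show "f dvd p"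
    proof (rule nondegenerate)
      fix q
      have "\<phi> ((p * q) * 1) = (\<Sum>j<?n. \<phi> (p * q * x j) * \<phi> (1 * x j))"
        by (rule parseval[OF x, symmetric])
      also have "\<dots> = 0" by (rule sum.neutral) (use ** in auto)
      finally show "\<phi> (p * q) = 0" by simp
    qed
  qed
  then have "is_minimal_polynomial A f"
    unfolding is_minimal_polynomial_def entry using monic by (simp add: A_def)
  moreover have "transpose_mat A = A" by (rule eq_matI) (simp_all add: A_def M_def mult_ac)
  moreover have "A \<in> carrier_mat ?n ?n" by (auto simp: A_def)
  ultimately show ?thesis by blast
qed

end

lemma exists_symmetric_matrix:
  fixes f :: "'a::field poly"
  assumes char: "CHAR('a) = 2" and monic: "lead_coeff f = 1" and deg: "degree f > 0"
    and ndp: "\<not> distinct_inseparable_product f"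
  shows "\<exists>A \<in> carrier_mat (degree f) (degree f). transpose_mat A = A \<and> is_minimal_polynomial A f"
proof -
  from exists_square_form_datum[OF char monic] ndp obtain u b
    where ub: "square_form_datum f u b" "\<not> f dvd b" by blast
  interpret frobenius_functional f "\<lambda>p. top_coeff f (u * p)"
  proof
    fix p q :: "'a poly" and c :: 'a
    show "degree f > 0" by (rule deg)
    show "top_coeff f (u * (p + q)) = top_coeff f (u * p) + top_coeff f (u * q)"
      by (simp add: distrib_left top_coeff_add)
    show "top_coeff f (u * smult c p) = c * top_coeff f (u * p)"
      by (simp add: top_coeff_smult)
    show "top_coeff f (u * p) = 0" if "f dvd p"
      using that by (simp add: top_coeff_eq_0_if_dvd)
    show "f dvd p" if "\<And>q. top_coeff f (u * (p * q)) = 0"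
    proof -
      have "f dvd u * p" using that by (intro top_coeff_nondegenerate[OF deg]) (simp add: mult.assoc)
      moreover have "comaximal f u" using ub(1) comaximal_commute by (auto simp: square_form_datum_def)
      ultimately show ?thesis using comaximal_dvd_mult_cancel by blast
    qed
  qed
  note square = top_coeff_square[OF char deg monic ub(1)]
  \<comment> \<open>The square of this value is the value of the form at \<open>q\<close>, so the
    form is not alternating.\<close>
  obtain q where "top_coeff f (b * q) \<noteq> 0" using ub(2) top_coeff_nondegenerate[OF deg] by blast
  then have "top_coeff f (u * (q * q)) \<noteq> 0" by (simp add: square)
  then obtain x where "orthonormal x (degree f)" using exists_orthonormal[OF char] square by blast
  then show ?thesis by (rule exists_symmetric_matrix_if_orthonormal[OF monic])
qed

section \<open>Polynomials with vanishing derivative\<close>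

lemma monic_irreducible_dvd_imp_eq:
  fixes p q :: "'a::field poly"
  assumes "irreducible p" "irreducible q" "lead_coeff p = 1" "lead_coeff q = 1" "q dvd p"
  shows "q = p"
proof -
  from assms(5) obtain h where h: "p = q * h" by blast
  have "\<not> q dvd 1" using assms(2) by (simp add: Factorial_Ring.irreducible_def)
  with assms(1) h have "h dvd 1" unfolding Factorial_Ring.irreducible_def by blast
  then obtain c where c: "h = [:c:]" by (auto elim: is_unit_polyE)
  have "lead_coeff h = 1" using assms(3,4) by (simp add: h lead_coeff_mult)
  with c show ?thesis by (simp add: h)
qed

lemma irreducible_dvd_prod_imp_mem:
  fixes S :: "'a::field poly set"
  assumes "finite S" "\<forall>p\<in>S. lead_coeff p = 1 \<and> irreducible p"
    and q: "irreducible q" "lead_coeff q = 1" "q dvd \<Prod>S"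
  shows "q \<in> S"
  using assms(1,2) q(3)
proof (induction S rule: finite_induct)
  case empty
  with q(1) show ?case by (simp add: Factorial_Ring.irreducible_def)
next
  case (insert p S)
  from insert.prems(2) insert.hyps have "q dvd p * \<Prod>S" by simp
  then have "q dvd p \<or> q dvd \<Prod>S"
    using field_poly_irreducible_imp_prime[OF q(1)] prime_elem_dvd_multD by blast
  then show ?case
    using insert.IH insert.prems(1) monic_irreducible_dvd_imp_eq[of p q] q by auto
qed

text \<open>An irreducible factor \<open>q\<close> of \<open>g\<close> would occur in
  \<open>S\<close> and still divide the product over \<open>S - {q}\<close>, hence lie in that
  set.\<close>

lemma square_dvd_prod_irreducible_imp_unit:
  fixes S :: "'a::field poly set"
  assumes S: "finite S" "\<forall>p\<in>S. lead_coeff p = 1 \<and> irreducible p" and g: "g\<^sup>2 dvd \<Prod>S"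
  shows "g dvd 1"
proof (rule ccontr)
  assume "\<not> g dvd 1"
  have nz: "\<Prod>S \<noteq> 0" using S by auto
  with g have "g \<noteq> 0" by auto
  with \<open>\<not> g dvd 1\<close> have "degree g > 0" by (simp add: is_unit_iff_degree)
  then obtain q where q: "irreducible q" "lead_coeff q = 1" "q dvd g"
    using exists_monic_irreducible_factor by blast
  from q(3) g have q2: "q * q dvd \<Prod>S"
    by (metis dvd_power_same dvd_trans power2_eq_square)
  then have "q dvd \<Prod>S" by (rule dvd_mult_left)
  then have qS: "q \<in> S" using irreducible_dvd_prod_imp_mem[OF S] q by blast
  then have "\<Prod>S = q * \<Prod>(S - {q})" using S(1) by (simp add: prod.remove)
  with q2 nz have "q dvd \<Prod>(S - {q})" by auto
  moreover have "finite (S - {q})" "\<forall>p\<in>S - {q}. lead_coeff p = 1 \<and> irreducible p" using S by auto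
  ultimately have "q \<in> S - {q}" using irreducible_dvd_prod_imp_mem[of "S - {q}" q] q(1,2) by blast
  then show False by simp
qed

lemma pderiv_prod_eq_0:
  fixes S :: "'a::field poly set"
  assumes "\<forall>p\<in>S. pderiv p = 0"
  shows "pderiv (\<Prod>S) = 0"
  using assms by (induction S rule: infinite_finite_induct) (simp_all add: pderiv_mult)

text \<open>The linear form with \<open>X^k \<mapsto> c k\<close>; if \<open>c k\<close> is an entry
  of \<open>A^k\<close>, it yields that entry of \<open>p(A)\<close>.\<close>

definition moment :: "(nat \<Rightarrow> 'a::field) \<Rightarrow> 'a poly \<Rightarrow> 'a" where
  "moment c p = (\<Sum>k\<le>degree p. coeff p k * c k)"

lemma moment_eq_sum:
  assumes "degree p \<le> N"
  shows "moment c p = (\<Sum>k\<le>N. coeff p k * c k)"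
  unfolding moment_def using assms by (intro sum.mono_neutral_left) (auto simp: coeff_eq_0)

lemma moment_add: "moment c (p + q) = moment c p + moment c q"
proof -
  let ?N = "max (degree p) (degree q)"
  have "degree (p + q) \<le> ?N" by (rule degree_add_le_max)
  then show ?thesis
    by (simp add: moment_eq_sum[of _ ?N] distrib_right sum.distrib)
qed

lemma moment_smult: "moment c (smult a p) = a * moment c p"
  by (simp add: moment_eq_sum[OF degree_smult_le] moment_def sum_distrib_left mult.assoc)

lemma moment_0 [simp]: "moment c 0 = 0"
  by (simp add: moment_def)

lemma moment_diff: "moment c (p - q) = moment c p - moment c q"
  using moment_add[of c "p - q" q] by simp

lemma moment_sum: "moment c (\<Sum>i\<in>I. g i) = (\<Sum>i\<in>I. moment c (g i))"
  by (induction I rule: infinite_finite_induct) (simp_all add: moment_add)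

lemma moment_monom: "moment c (monom a k) = a * c k"
  by (simp add: moment_eq_sum[OF degree_monom_le] if_distrib[of "\<lambda>x. x * _"] cong: if_cong)

lemma moment_pCons_0: "moment c (pCons 0 p) = moment (\<lambda>k. c (Suc k)) p"
proof -
  have "degree (pCons 0 p) \<le> Suc (degree p)" by (rule degree_pCons_le)
  then show ?thesis by (simp add: moment_eq_sum[of "pCons 0 p"] moment_def sum.atMost_Suc_shift del: sum.atMost_Suc)
qed

lemma moment_sum_seq: "moment (\<lambda>k. \<Sum>b\<in>B. a b * c b k) p = (\<Sum>b\<in>B. a b * moment (c b) p)"
  unfolding moment_def sum_distrib_left by (subst sum.swap) (simp add: mult_ac)

text \<open>A coefficient of odd index reappears in the derivative with an odd factor, which is
  \<open>1\<close>. Summing up to \<open>degree f\<close> only adds zero terms.\<close>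

lemma char_two_even_poly:
  fixes f :: "'a::field poly"
  assumes char: "CHAR('a) = 2" and "pderiv f = 0"
  shows "f = (\<Sum>i\<le>degree f. monom (coeff f (2 * i)) (2 * i))"
proof (rule poly_eqI)
  fix k
  have "coeff (\<Sum>i\<le>degree f. monom (coeff f (2 * i)) (2 * i)) k =
      (\<Sum>i\<le>degree f. if 2 * i = k then coeff f k else 0)"
    by (simp add: coeff_sum) (intro sum.cong, auto)
  also have "\<dots> = coeff f k"
  proof (cases "even k")
    case True
    then obtain j where k: "k = 2 * j" by blast
    have "j \<le> degree f" if "coeff f k \<noteq> 0" using le_degree[OF that] k by simp
    then show ?thesis by (cases "coeff f k = 0") (simp_all add: k)
  next
    case False
    then obtain j where k: "k = Suc (2 * j)" by (metis oddE Suc_eq_plus1)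
    have "of_nat (2 * j) = (0::'a)" unfolding of_nat_eq_0_iff_char_dvd char by simp
    then have "of_nat (Suc (2 * j)) = (1::'a)" by (simp only: of_nat_Suc add_0_right)
    then have "coeff f k = coeff (pderiv f) (2 * j)" by (simp only: coeff_pderiv k mult_1)
    then show ?thesis using assms(2) by (simp cong: if_cong)
  qed
  finally show "coeff f k = coeff (\<Sum>i\<le>degree f. monom (coeff f (2 * i)) (2 * i)) k" by simp
qed

lemma char_two_power2_poly:
  fixes p :: "'a::field poly"
  assumes "CHAR('a) = 2" "degree p \<le> D"
  shows "p\<^sup>2 = (\<Sum>j\<le>D. monom ((coeff p j)\<^sup>2) (2 * j))"
proof -
  have "p\<^sup>2 = (\<Sum>j\<le>D. monom (coeff p j) j)\<^sup>2" using assms(2) by (simp add: poly_as_sum_of_monoms')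
  also have "\<dots> = (\<Sum>j\<le>D. (monom (coeff p j) j)\<^sup>2)" using assms(1) by (intro char_two_power2_sum) simp
  finally show ?thesis by (simp add: monom_power mult.commute)
qed

section \<open>Powers of symmetric matrices and their annihilating polynomials\<close>

lemma pow_mat_add:
  fixes A :: "'a::semiring_1 mat"
  assumes A: "A \<in> carrier_mat m m"
  shows "A ^\<^sub>m (i + j) = A ^\<^sub>m i * A ^\<^sub>m j"
proof (induction j)
  case 0
  show ?case using A by (simp add: right_mult_one_mat[OF pow_carrier_mat[OF A]])
next
  case (Suc j)
  then show ?case using assoc_mult_mat[OF pow_carrier_mat[OF A] pow_carrier_mat[OF A] A] by simp
qed

lemma transpose_pow_mat:
  fixes A :: "'a::comm_semiring_1 mat"
  assumes A: "A \<in> carrier_mat m m" and sym: "transpose_mat A = A"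
  shows "transpose_mat (A ^\<^sub>m k) = A ^\<^sub>m k"
proof (induction k)
  case 0
  show ?case by simp
next
  case (Suc k)
  have "transpose_mat (A ^\<^sub>m Suc k) = A * A ^\<^sub>m k"
    using transpose_mult[OF pow_carrier_mat[OF A] A] Suc sym by simp
  also have "\<dots> = A ^\<^sub>m Suc k" using pow_mat_add[OF A, of 1 k] A by simp
  finally show ?case .
qed

text \<open>For symmetric \<open>B\<close> the diagonal of \<open>B\<^sup>2\<close> consists of the squares of the entries of \<open>B 1\<close>, where \<open>1\<close> is
  the all-ones vector. With \<open>f = \<Sum> c\<^sub>i X\<^bsup>2i\<^esup>\<close> the diagonal of \<open>f(A) = 0\<close> therefore reads
  \<open>\<Sum> c\<^sub>i (A\<^sup>i 1)\<^sub>a\<^sup>2 = 0\<close>, and this forces the square of the minimal polynomial \<open>g\<close> of the vector \<open>1\<close>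
  to divide \<open>f\<close>: with \<open>r\<^sub>i = X\<^sup>i mod g\<close> one gets \<open>\<Sum> c\<^sub>i r\<^sub>i\<^sup>2 = 0\<close>, so \<open>f = \<Sum> c\<^sub>i (X\<^sup>i - r\<^sub>i)\<^sup>2\<close>.\<close>

lemma symmetric_annihilator_square_factor:
  fixes A :: "'a::field mat"
  assumes char: "CHAR('a) = 2" and A: "A \<in> carrier_mat m m" and sym: "transpose_mat A = A"
    and m: "m > 0" and f0: "f \<noteq> 0" and df: "pderiv f = 0" and ann: "poly_mat f A = 0\<^sub>m m m"
  shows "\<exists>g. \<not> g dvd 1 \<and> g\<^sup>2 dvd f"
proof -
  have dimA [simp]: "dim_row A = m" "dim_col A = m" using A by auto
  have powA: "A ^\<^sub>m k \<in> carrier_mat m m" for k by (rule pow_carrier_mat[OF A])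
  have dimP [simp]: "dim_row (A ^\<^sub>m k) = m" "dim_col (A ^\<^sub>m k) = m" for k using powA by auto
  have mult_entry: "(B * C) $$ (a, b) = (\<Sum>j<m. B $$ (a, j) * C $$ (j, b))"
    if "B \<in> carrier_mat m m" "C \<in> carrier_mat m m" "a < m" "b < m" for B C :: "'a mat" and a b
    using that by (auto simp: scalar_prod_def lessThan_atLeast0)
  \<comment> \<open>The row sums of \<open>A^k\<close> are the entries of the vector
    \<open>A^k 1\<close>.\<close>
  define v where "v k a = (\<Sum>b<m. (A ^\<^sub>m k) $$ (a, b))" for k a
  have v_0: "v 0 a = 1" if "a < m" for a
    using that by (simp add: v_def)
  have v_Suc: "v (Suc k) a = (\<Sum>j<m. A $$ (a, j) * v k j)" if a: "a < m" for k a
  proof -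
    have "A ^\<^sub>m Suc k = A * A ^\<^sub>m k" using pow_mat_add[OF A, of 1 k] A by simp
    then have "v (Suc k) a = (\<Sum>b<m. \<Sum>j<m. A $$ (a, j) * (A ^\<^sub>m k) $$ (j, b))"
      unfolding v_def using mult_entry[OF A powA a] by (intro sum.cong) auto
    then show ?thesis by (subst (asm) sum.swap) (simp add: v_def sum_distrib_left)
  qed
  have diag: "(A ^\<^sub>m (2 * k)) $$ (a, a) = (v k a)\<^sup>2" if a: "a < m" for k a
  proof -
    have "(A ^\<^sub>m (2 * k)) $$ (a, a) = (\<Sum>j<m. (A ^\<^sub>m k) $$ (a, j) * (A ^\<^sub>m k) $$ (j, a))"
      using pow_mat_add[OF A, of k k] mult_entry[OF powA powA a a] by (simp add: mult_2)
    also have "\<dots> = (\<Sum>j<m. ((A ^\<^sub>m k) $$ (a, j))\<^sup>2)"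
    proof (rule sum.cong)
      fix j assume "j \<in> {..<m}"
      then have "transpose_mat (A ^\<^sub>m k) $$ (a, j) = (A ^\<^sub>m k) $$ (j, a)" using a by simp
      then show "(A ^\<^sub>m k) $$ (a, j) * (A ^\<^sub>m k) $$ (j, a) = ((A ^\<^sub>m k) $$ (a, j))\<^sup>2"
        by (simp add: transpose_pow_mat[OF A sym] power2_eq_square)
    qed simp
    finally show ?thesis by (simp add: v_def char_two_power2_sum[OF char])
  qed
  \<comment> \<open>\<open>W p\<close> is the vector \<open>p(A) 1\<close>, so \<open>I\<close> is
    the annihilator of the all-ones vector. It is an ideal since
    \<open>(X p)(A) 1 = A (p(A) 1)\<close>.\<close>
  define W where "W p a = moment (\<lambda>k. v k a) p" for p a
  define I where "I = {p. \<forall>a<m. W p a = 0}"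
  have W_add: "W (p + q) a = W p a + W q a" and W_smult: "W (smult c p) a = c * W p a"
    and W_diff: "W (p - q) a = W p a - W q a" for p q a c
    by (simp_all add: W_def moment_add moment_smult moment_diff)
  have I_mult: "p * q \<in> I" if p: "p \<in> I" for p q
  proof (induction q)
    case 0
    show ?case by (simp add: I_def W_def)
  next
    case (pCons c q)
    have "W (pCons 0 (p * q)) a = 0" if "a < m" for a
    proof -
      have "W (pCons 0 (p * q)) a = moment (\<lambda>k. \<Sum>j<m. A $$ (a, j) * v k j) (p * q)"
        unfolding W_def moment_pCons_0 v_Suc[OF that] ..
      also have "\<dots> = (\<Sum>j<m. A $$ (a, j) * W (p * q) j)" unfolding W_def by (rule moment_sum_seq)
      also have "\<dots> = 0" using pCons.IH by (intro sum.neutral) (auto simp: I_def)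
      finally show ?thesis .
    qed
    then show ?case using p by (simp add: I_def W_add W_smult)
  qed
  have entry: "poly_mat f A $$ (a, b) = moment (\<lambda>k. (A ^\<^sub>m k) $$ (a, b)) f" if "a < m" "b < m" for a b
    using that by (simp add: poly_mat_def moment_def)
  have fI: "f \<in> I"
  proof -
    have "W f a = 0" if "a < m" for a
    proof -
      have "W f a = (\<Sum>b<m. 1 * moment (\<lambda>k. (A ^\<^sub>m k) $$ (a, b)) f)"
        unfolding W_def v_def by (subst moment_sum_seq[symmetric]) simp
      also have "\<dots> = 0" using that ann by (intro sum.neutral) (simp add: entry[symmetric])
      finally show ?thesis .
    qed
    then show ?thesis by (simp add: I_def)
  qed
  have "\<exists>g. (g \<in> I \<and> g \<noteq> 0) \<and> (\<forall>y. y \<in> I \<and> y \<noteq> 0 \<longrightarrow> degree g \<le> degree y)"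
    by (rule ex_has_least_nat[of _ f]) (use fI f0 in simp)
  then obtain g where g: "g \<in> I" "g \<noteq> 0" and least: "\<And>y. y \<in> I \<Longrightarrow> y \<noteq> 0 \<Longrightarrow> degree g \<le> degree y"
    by blast
  define d where "d = degree g"
  \<comment> \<open>\<open>W 1\<close> is the all-ones vector itself, nonzero because
    \<open>m > 0\<close>; hence \<open>g\<close> is not a unit.\<close>
  have "1 \<notin> I"
  proof
    assume "1 \<in> I"
    then have "W 1 0 = 0" using m by (simp add: I_def)
    moreover have "W 1 0 = v 0 0" using moment_monom[of "\<lambda>k. v k 0" 1 0] by (simp add: W_def)
    ultimately show False using v_0[OF m] by simp
  qed
  then have unit: "\<not> g dvd 1" using I_mult[OF g(1)] unfolding dvd_def by metis
  then have d: "d > 0" using g(2) by (simp add: d_def is_unit_iff_degree)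
  \<comment> \<open>\<open>V\<close> stores the vector \<open>p(A) 1\<close> as a polynomial. By
    minimality of \<open>g\<close> it is injective on degrees below \<open>d\<close>, hence has a
    linear left inverse \<open>L\<close> there.\<close>
  define V where "V p = (\<Sum>a<m. monom (W p a) a)" for p
  have coeff_V: "coeff (V p) a = (if a < m then W p a else 0)" for p a
    by (simp add: V_def coeff_sum if_distrib cong: if_cong)
  interpret vp: vector_space_pair "smult :: 'a \<Rightarrow> 'a poly \<Rightarrow> 'a poly" "smult :: 'a \<Rightarrow> 'a poly \<Rightarrow> 'a poly"
    by unfold_locales
  have V_linear: "Vector_Spaces.linear smult smult V"
    by unfold_locales (auto intro!: poly_eqI simp: coeff_V W_add W_smult)
  have sub: "poly_vs.subspace {p :: 'a poly. degree p < d}"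
    using d by (auto simp: poly_vs.subspace_def intro: degree_add_less le_less_trans[OF degree_smult_le])
  have V_inj: "inj_on V {p. degree p < d}"
  proof (rule inj_onI)
    fix p q assume pq: "p \<in> {p. degree p < d}" "q \<in> {p. degree p < d}" "V p = V q"
    have "W p a = W q a" if "a < m" for a using coeff_V[of p a] coeff_V[of q a] pq(3) that by simp
    then have "p - q \<in> I" by (simp add: I_def W_diff)
    moreover have "degree (p - q) < d" using pq by (auto intro: degree_diff_less)
    ultimately show "p = q" using least[of "p - q"] by (force simp: d_def)
  qed
  from vp.linear_exists_left_inverse_on[OF V_linear sub V_inj] obtain L
    where L: "Vector_Spaces.linear smult smult L" and LV: "\<And>p. degree p < d \<Longrightarrow> L (V p) = p" by blast
  interpret L: Vector_Spaces.linear smult smult L by (rule L)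
  \<comment> \<open>The matrix entries of \<open>L\<close>: they recover the coefficients of
    \<open>p\<close>, of degree below \<open>d\<close>, from \<open>p(A) 1\<close>.\<close>
  define w where "w j a = coeff (L (monom 1 a)) j" for j a
  have dual: "(\<Sum>a<m. w j a * W p a) = coeff p j" if "degree p < d" for p j
  proof -
    have "V p = (\<Sum>a<m. smult (W p a) (monom 1 a))" by (simp add: V_def smult_monom)
    then have "L (V p) = (\<Sum>a<m. smult (W p a) (L (monom 1 a)))" by (simp only: L.sum L.scale)
    then have "coeff p j = coeff (\<Sum>a<m. smult (W p a) (L (monom 1 a))) j" using LV[OF that] by simp
    then show ?thesis by (simp add: coeff_sum w_def mult.commute)
  qed
  define R :: "nat \<Rightarrow> 'a poly" where "R i = monom 1 i mod g" for i
  have g_dvd: "g dvd monom 1 i - R i" for i by (simp add: R_def minus_mod_eq_mult_div)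
  have degR: "degree (R i) < d" for i
    using degree_mod_less[OF g(2), of "monom 1 i"] d by (auto simp: R_def d_def)
  \<comment> \<open>\<open>X^i - R i\<close> is a multiple of \<open>g\<close>, so
    \<open>R i\<close> evaluated at \<open>A\<close> sends the all-ones vector to
    \<open>A^i 1\<close>.\<close>
  have coeff_R: "(\<Sum>a<m. w j a * v i a) = coeff (R i) j" for i j
  proof -
    from g_dvd[of i] obtain h where "monom 1 i - R i = g * h" by blast
    then have "monom 1 i - R i \<in> I" using I_mult[OF g(1)] by simp
    then have "W (R i) a = v i a" if "a < m" for a
      using that moment_monom[of "\<lambda>k. v k a" 1 i] by (simp add: I_def W_diff) (simp add: W_def)
    then have "(\<Sum>a<m. w j a * v i a) = (\<Sum>a<m. w j a * W (R i) a)" by simp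
    then show ?thesis using dual[OF degR] by simp
  qed
  define c where "c i = coeff f (2 * i)" for i
  have f_eq: "f = (\<Sum>i\<le>degree f. monom (c i) (2 * i))"
    unfolding c_def by (rule char_two_even_poly[OF char df])
  have diag_sum: "(\<Sum>i\<le>degree f. c i * (v i a)\<^sup>2) = 0" if a: "a < m" for a
  proof -
    have "0 = moment (\<lambda>k. (A ^\<^sub>m k) $$ (a, a)) f" using entry[OF a a] ann a by simp
    also have "\<dots> = moment (\<lambda>k. (A ^\<^sub>m k) $$ (a, a)) (\<Sum>i\<le>degree f. monom (c i) (2 * i))"
      using f_eq by simp
    also have "\<dots> = (\<Sum>i\<le>degree f. c i * (v i a)\<^sup>2)"
      by (simp add: moment_sum moment_monom diag[OF a])
    finally show ?thesis by simp
  qed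
  \<comment> \<open>Squaring is additive, so \<open>coeff_R\<close> turns this into a combination of
    the diagonal relations with weights \<open>(w j a)^2\<close>.\<close>
  have R_sum: "(\<Sum>i\<le>degree f. c i * (coeff (R i) j)\<^sup>2) = 0" for j
  proof -
    have "(\<Sum>i\<le>degree f. c i * (coeff (R i) j)\<^sup>2) = (\<Sum>i\<le>degree f. \<Sum>a<m. (w j a)\<^sup>2 * (c i * (v i a)\<^sup>2))"
      by (simp add: coeff_R[symmetric] char_two_power2_sum[OF char] power_mult_distrib sum_distrib_left mult_ac)
    also have "\<dots> = (\<Sum>a<m. (w j a)\<^sup>2 * (\<Sum>i\<le>degree f. c i * (v i a)\<^sup>2))"
      by (subst sum.swap) (simp add: sum_distrib_left)
    also have "\<dots> = 0" using diag_sum by simp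
    finally show ?thesis .
  qed
  have "(\<Sum>i\<le>degree f. smult (c i) ((R i)\<^sup>2)) =
      (\<Sum>i\<le>degree f. \<Sum>j\<le>d. monom (c i * (coeff (R i) j)\<^sup>2) (2 * j))"
    using degR by (simp add: char_two_power2_poly[OF char, of _ d] less_imp_le
        poly_vs.scale_sum_right smult_monom)
  also have "\<dots> = (\<Sum>j\<le>d. monom (\<Sum>i\<le>degree f. c i * (coeff (R i) j)\<^sup>2) (2 * j))"
    by (subst sum.swap) (simp add: monom_sum)
  also have "\<dots> = 0" by (simp add: R_sum)
  finally have R_zero: "(\<Sum>i\<le>degree f. smult (c i) ((R i)\<^sup>2)) = 0" .
  have "(monom 1 i - R i)\<^sup>2 = monom 1 (2 * i) + (R i)\<^sup>2" for i
    using char_two_power2_add[of "monom 1 i" "- R i"] char by (simp add: monom_power mult.commute)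
  then have "(\<Sum>i\<le>degree f. smult (c i) ((monom 1 i - R i)\<^sup>2)) =
      (\<Sum>i\<le>degree f. monom (c i) (2 * i)) + (\<Sum>i\<le>degree f. smult (c i) ((R i)\<^sup>2))"
    by (simp add: smult_add_right smult_monom sum.distrib)
  also have "\<dots> = f" using R_zero f_eq by simp
  finally have "f = (\<Sum>i\<le>degree f. smult (c i) ((monom 1 i - R i)\<^sup>2))" ..
  moreover have "g\<^sup>2 dvd (\<Sum>i\<le>degree f. smult (c i) ((monom 1 i - R i)\<^sup>2))"
    using g_dvd by (intro dvd_sum dvd_smult dvd_power_same)
  ultimately show ?thesis using unit by metis
qed

text \<open>Inseparable irreducible factors have zero derivative, so \<open>f' = 0\<close> and
  \<open>f\<close> would have a square factor, impossible for a product of distinct irreducible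
  polynomials.\<close>

lemma symmetric_minimal_polynomial_imp_not_distinct:
  fixes f :: "'a::field poly"
  assumes char: "CHAR('a) = 2" and deg: "degree f > 0"
    and A: "A \<in> carrier_mat m m" "transpose_mat A = A" "is_minimal_polynomial A f"
  shows "\<not> distinct_inseparable_product f"
proof
  assume "distinct_inseparable_product f"
  then obtain S where S: "finite S" "f = \<Prod>S"
    "\<forall>p\<in>S. lead_coeff p = 1 \<and> irreducible p \<and> \<not> separable_poly p"
    unfolding distinct_inseparable_product_def by blast
  have df: "pderiv f = 0"
    unfolding S(2) using S(3) irreducible_separable_iff_pderiv by (intro pderiv_prod_eq_0) blast
  from deg have f0: "f \<noteq> 0" by auto
  have zero_iff: "poly_mat p A = 0\<^sub>m m m \<longleftrightarrow> f dvd p" for p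
    using A by (auto simp: is_minimal_polynomial_def)
  \<comment> \<open>Every polynomial annihilates the matrix of size \<open>0\<close>, so its minimal
    polynomial would be \<open>1\<close>.\<close>
  have "m > 0"
  proof (rule ccontr)
    assume "\<not> m > 0"
    then have "poly_mat 1 A = 0\<^sub>m m m" using A(1) by (intro eq_matI) (auto simp: poly_mat_def)
    then have "f dvd 1" by (simp only: zero_iff)
    with deg show False by (simp add: is_unit_iff_degree[OF f0])
  qed
  from symmetric_annihilator_square_factor[OF char A(1,2) this f0 df] zero_iff
  obtain g where "\<not> g dvd 1" "g\<^sup>2 dvd f" by auto
  with square_dvd_prod_irreducible_imp_unit[of S g] S show False by blast
qed

theorem theorem1p1:
  fixes f :: "'k::field poly" and n :: nat
  assumes "CHAR('k) = 2"
    and "Polynomial.lead_coeff f = 1"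
    and "Polynomial.degree f = n"
    and "n \<ge> 1"
  shows "((\<exists>m. \<exists>A \<in> carrier_mat m m. transpose_mat A = A \<and> is_minimal_polynomial A f)
            \<longleftrightarrow> \<not> distinct_inseparable_product f)
       \<and> ((\<exists>m. \<exists>A \<in> carrier_mat m m. transpose_mat A = A \<and> is_minimal_polynomial A f)
            \<longrightarrow> (\<exists>A \<in> carrier_mat n n. transpose_mat A = A \<and> is_minimal_polynomial A f))
       \<and> (perfect_field TYPE('k)
            \<longrightarrow> (\<exists>A \<in> carrier_mat n n. transpose_mat A = A \<and> is_minimal_polynomial A f))"
proof -
  have deg: "degree f > 0" using assms(3,4) by simp
  have nec: "\<not> distinct_inseparable_product f"
    if "\<exists>m. \<exists>A \<in> carrier_mat m m. transpose_mat A = A \<and> is_minimal_polynomial A f"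
    using that symmetric_minimal_polynomial_imp_not_distinct[OF assms(1) deg] by blast
  have suf: "\<exists>A \<in> carrier_mat n n. transpose_mat A = A \<and> is_minimal_polynomial A f"
    if "\<not> distinct_inseparable_product f"
    using exists_symmetric_matrix[OF assms(1,2) deg that] assms(3) by simp
  have perf: "\<not> distinct_inseparable_product f" if "perfect_field TYPE('k)"
  proof
    assume "distinct_inseparable_product f"
    then obtain S where "f = \<Prod>S" "\<forall>p\<in>S. irreducible p \<and> \<not> separable_poly p"
      unfolding distinct_inseparable_product_def by blast
    moreover from this(2) that have "S = {}" unfolding perfect_field_def by blast
    ultimately show False using deg by simp
  qed
  show ?thesis using nec suf perf by blast
qed

end
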